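(* Let $G$ be an ample étale groupoid with locally compact Hausdorff unit space. Then there is a one-to-one correspondence (bijection) between the set of all open wide subgroupoids of $G$ and the set of all wide join closed subsemigroups of $I(G)$.
   Context: A topological groupoid $G$ with source and range maps $d,r\colon G\to G^{(0)}$ is étale if $d$ is a local homeomorphism; an étale groupoid is ample if it has a basis of its topology consisting of compact open sets. A subgroupoid (subset closed under multiplication and inversion) is wide if it contains $G^{(0)}$. An open set $U\subset G$ is a bisection if $d|_U$ and $r|_U$ are homeomorphisms onto their images. $I(G)$ is the set of all compact (open) bisections of $G$; it is an inverse semigroup under $UV:=\{\alpha\beta\mid \alpha\in U,\beta\in V,d(\alpha)=r(\beta)\}$, with inverse $U^{-1}=\{\alpha^{-1}\mid\alpha\in U\}$ and zero $\emptyset$. $E(I(G))$ denotes its set of idempotents. A subsemigroup of $I(G)$ is a subset closed under products and inverses; it is wide if it contains $E(I(G))$. A pair $U,V\in I(G)$ is compatible if $U^{-1}V,UV^{-1}\in E(I(G))$; in that case $U\cup V\in I(G)$ is the least upper bound (join) of $U,V$ with respect to inclusion. A subsemigroup $T\subset I(G)$ is join closed if $U\cup V\in T$ for every compatible pair $U,V\in T$. *)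

theory Defs
  imports "HOL-Analysis.Analysis"
begin

text \<open>
  A groupoid is given by its set of arrows together with a topology on it; the arrows are the
  points of the topology \<open>arr_top G\<close>. Units are identified with identity arrows, and
  \<open>mul G a b\<close> is meaningful only if the source of \<open>a\<close> is the range of \<open>b\<close>.
\<close>

record 'a groupoid_struct =
  arr_top :: "'a topology"
  units :: "'a set"
  src :: "'a \<Rightarrow> 'a"
  rng :: "'a \<Rightarrow> 'a"
  mul :: "'a \<Rightarrow> 'a \<Rightarrow> 'a"
  ginv :: "'a \<Rightarrow> 'a"

abbreviation arrows :: "('a, 'b) groupoid_struct_scheme \<Rightarrow> 'a set" where
  "arrows G \<equiv> topspace (arr_top G)"

definition composable :: "('a, 'b) groupoid_struct_scheme \<Rightarrow> ('a \<times> 'a) set" where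
  "composable G = {(a, b). a \<in> arrows G \<and> b \<in> arrows G \<and> src G a = rng G b}"

definition unit_space :: "('a, 'b) groupoid_struct_scheme \<Rightarrow> 'a topology" where
  "unit_space G = subtopology (arr_top G) (units G)"

locale groupoid =
  fixes G :: "('a, 'b) groupoid_struct_scheme"
  assumes units_subset: "units G \<subseteq> arrows G"
    and src_units: "a \<in> arrows G \<Longrightarrow> src G a \<in> units G"
    and rng_units: "a \<in> arrows G \<Longrightarrow> rng G a \<in> units G"
    and src_unit: "x \<in> units G \<Longrightarrow> src G x = x"
    and rng_unit: "x \<in> units G \<Longrightarrow> rng G x = x"
    and mul_closed: "(a, b) \<in> composable G \<Longrightarrow> mul G a b \<in> arrows G"
    and src_mul: "(a, b) \<in> composable G \<Longrightarrow> src G (mul G a b) = src G b"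
    and rng_mul: "(a, b) \<in> composable G \<Longrightarrow> rng G (mul G a b) = rng G a"
    and mul_assoc: "\<lbrakk>(a, b) \<in> composable G; (b, c) \<in> composable G\<rbrakk>
      \<Longrightarrow> mul G (mul G a b) c = mul G a (mul G b c)"
    and mul_src: "a \<in> arrows G \<Longrightarrow> mul G a (src G a) = a"
    and rng_mul_left: "a \<in> arrows G \<Longrightarrow> mul G (rng G a) a = a"
    and inv_closed: "a \<in> arrows G \<Longrightarrow> ginv G a \<in> arrows G"
    and src_inv: "a \<in> arrows G \<Longrightarrow> src G (ginv G a) = rng G a"
    and rng_inv: "a \<in> arrows G \<Longrightarrow> rng G (ginv G a) = src G a"
    and inv_mul: "a \<in> arrows G \<Longrightarrow> mul G (ginv G a) a = src G a"
    and mul_inv: "a \<in> arrows G \<Longrightarrow> mul G a (ginv G a) = rng G a"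

text \<open>
  Continuity of the source and range maps is a consequence of the two conditions below.
\<close>

locale topological_groupoid = groupoid +
  assumes continuous_mul:
    "continuous_map (subtopology (prod_topology (arr_top G) (arr_top G)) (composable G))
       (arr_top G) (\<lambda>(a, b). mul G a b)"
    and continuous_inv: "continuous_map (arr_top G) (arr_top G) (ginv G)"

definition local_homeomorphism_map ::
    "'a topology \<Rightarrow> 'b topology \<Rightarrow> ('a \<Rightarrow> 'b) \<Rightarrow> bool" where
  "local_homeomorphism_map X Y f \<longleftrightarrow>
     (\<forall>x \<in> topspace X. \<exists>U. openin X U \<and> x \<in> U \<and> openin Y (f ` U) \<and>
        homeomorphic_map (subtopology X U) (subtopology Y (f ` U)) f)"

locale etale_groupoid = topological_groupoid +
  assumes local_homeomorphism_src: "local_homeomorphism_map (arr_top G) (unit_space G) (src G)"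

text \<open>
  The arrow space is not assumed to be Hausdorff; compactness means the finite subcover property.
\<close>

locale ample_groupoid = etale_groupoid +
  assumes compact_open_basis:
    "\<exists>B. (\<forall>K \<in> B. openin (arr_top G) K \<and> compactin (arr_top G) K) \<and>
         openin (arr_top G) = arbitrary union_of (\<lambda>K. K \<in> B)"

definition open_wide_subgroupoid :: "('a, 'b) groupoid_struct_scheme \<Rightarrow> 'a set \<Rightarrow> bool" where
  "open_wide_subgroupoid G H \<longleftrightarrow>
     openin (arr_top G) H \<and> units G \<subseteq> H \<and>
     (\<forall>a \<in> H. \<forall>b \<in> H. src G a = rng G b \<longrightarrow> mul G a b \<in> H) \<and>
     (\<forall>a \<in> H. ginv G a \<in> H)"

definition open_bisection :: "('a, 'b) groupoid_struct_scheme \<Rightarrow> 'a set \<Rightarrow> bool" where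
  "open_bisection G U \<longleftrightarrow>
     openin (arr_top G) U \<and>
     homeomorphic_map (subtopology (arr_top G) U) (subtopology (unit_space G) (src G ` U)) (src G) \<and>
     homeomorphic_map (subtopology (arr_top G) U) (subtopology (unit_space G) (rng G ` U)) (rng G)"

definition compact_bisections :: "('a, 'b) groupoid_struct_scheme \<Rightarrow> 'a set set" where
  "compact_bisections G = {U. open_bisection G U \<and> compactin (arr_top G) U}"

definition set_mul :: "('a, 'b) groupoid_struct_scheme \<Rightarrow> 'a set \<Rightarrow> 'a set \<Rightarrow> 'a set" where
  "set_mul G U V = {mul G a b | a b. a \<in> U \<and> b \<in> V \<and> src G a = rng G b}"

definition set_inv :: "('a, 'b) groupoid_struct_scheme \<Rightarrow> 'a set \<Rightarrow> 'a set" where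
  "set_inv G U = ginv G ` U"

definition idempotent_bisections :: "('a, 'b) groupoid_struct_scheme \<Rightarrow> 'a set set" where
  "idempotent_bisections G = {U \<in> compact_bisections G. set_mul G U U = U}"

definition compatible :: "('a, 'b) groupoid_struct_scheme \<Rightarrow> 'a set \<Rightarrow> 'a set \<Rightarrow> bool" where
  "compatible G U V \<longleftrightarrow>
     set_mul G (set_inv G U) V \<in> idempotent_bisections G \<and>
     set_mul G U (set_inv G V) \<in> idempotent_bisections G"

definition bisection_subsemigroup ::
    "('a, 'b) groupoid_struct_scheme \<Rightarrow> 'a set set \<Rightarrow> bool" where
  "bisection_subsemigroup G T \<longleftrightarrow>
     T \<subseteq> compact_bisections G \<and>
     (\<forall>U \<in> T. \<forall>V \<in> T. set_mul G U V \<in> T) \<and>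
     (\<forall>U \<in> T. set_inv G U \<in> T)"

definition wide_subsemigroup :: "('a, 'b) groupoid_struct_scheme \<Rightarrow> 'a set set \<Rightarrow> bool" where
  "wide_subsemigroup G T \<longleftrightarrow>
     bisection_subsemigroup G T \<and> idempotent_bisections G \<subseteq> T"

definition join_closed :: "('a, 'b) groupoid_struct_scheme \<Rightarrow> 'a set set \<Rightarrow> bool" where
  "join_closed G T \<longleftrightarrow> (\<forall>U \<in> T. \<forall>V \<in> T. compatible G U V \<longrightarrow> U \<union> V \<in> T)"

end

theory Submission
  imports Defs
begin

text \<open>
  An open wide subgroupoid \<open>H\<close> corresponds to the set of compact bisections contained in \<open>H\<close>, and
  \<open>T\<close> corresponds to \<open>\<Union>T\<close>. Compact bisections form a basis of the topology, which recovers \<open>H\<close>.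
  Conversely, let a compact bisection \<open>U\<close> be covered by \<open>T\<close>. If \<open>K \<subseteq> U \<inter> V\<close> is a compact bisection
  and \<open>V \<in> T\<close>, then \<open>K = V \<cdot> d(K)\<close> with \<open>d(K)\<close> idempotent, so \<open>K \<in> T\<close>. By compactness \<open>U\<close> is a finite
  union of such sets, and these are pairwise compatible because they lie in the single bisection \<open>U\<close>.
\<close>

section \<open>Local homeomorphisms and restrictions of open maps\<close>

lemma local_homeomorphism_map_imp_continuous_map:
  assumes "local_homeomorphism_map X Y f"
  shows "continuous_map X Y f"
proof -
  have im: "f x \<in> topspace Y" if "x \<in> topspace X" for x
    using assms that openin_subset unfolding local_homeomorphism_map_def by fastforce
  have "openin X {x \<in> topspace X. f x \<in> V}" if V: "openin Y V" for V
  proof (subst openin_subopen, intro ballI)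
    fix x assume "x \<in> {x \<in> topspace X. f x \<in> V}"
    then have x: "x \<in> topspace X" "f x \<in> V" by auto
    obtain U where U: "openin X U" "x \<in> U"
      and h: "homeomorphic_map (subtopology X U) (subtopology Y (f ` U)) f"
      using assms x unfolding local_homeomorphism_map_def by blast
    have "continuous_map (subtopology X U) Y f"
      using homeomorphic_imp_continuous_map[OF h] continuous_map_in_subtopology by blast
    then have "openin (subtopology X U) {x \<in> topspace (subtopology X U). f x \<in> V}"
      using V openin_continuous_map_preimage by blast
    then have "openin X {x \<in> topspace (subtopology X U). f x \<in> V}"
      using U openin_open_subtopology by blast
    then show "\<exists>W. openin X W \<and> x \<in> W \<and> W \<subseteq> {x \<in> topspace X. f x \<in> V}"
      using x U by (intro exI[of _ "{x \<in> topspace (subtopology X U). f x \<in> V}"]) auto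
  qed
  with im show ?thesis by (auto simp: continuous_map_def)
qed

lemma local_homeomorphism_map_imp_open_map:
  assumes "local_homeomorphism_map X Y f"
  shows "open_map X Y f"
  unfolding open_map_def
proof (intro allI impI)
  fix W assume W: "openin X W"
  show "openin Y (f ` W)"
  proof (subst openin_subopen, intro ballI)
    fix y assume "y \<in> f ` W"
    then obtain x where x: "x \<in> W" "y = f x" by blast
    then have "x \<in> topspace X" using W openin_subset by blast
    then obtain U where U: "openin X U" "x \<in> U" "openin Y (f ` U)"
      and h: "homeomorphic_map (subtopology X U) (subtopology Y (f ` U)) f"
      using assms unfolding local_homeomorphism_map_def by blast
    have "openin (subtopology X U) (W \<inter> U)"
      using W by (simp add: openin_subtopology_Int)
    then have "openin (subtopology Y (f ` U)) (f ` (W \<inter> U))"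
      using homeomorphic_imp_open_map[OF h] by (simp add: open_map_def)
    then have "openin Y (f ` (W \<inter> U))"
      using U openin_open_subtopology by blast
    then show "\<exists>V. openin Y V \<and> y \<in> V \<and> V \<subseteq> f ` W"
      using x U by blast
  qed
qed

text \<open>Restricting to an open set keeps a continuous open map continuous and open onto its
  image, so injectivity is all that is missing. Applied to source and range, this reduces being an
  open bisection to openness and two injectivity conditions.\<close>

lemma homeomorphic_map_open_subset:
  assumes "continuous_map X Y f" "open_map X Y f" "openin X U" "inj_on f U"
  shows "homeomorphic_map (subtopology X U) (subtopology Y (f ` U)) f"
proof (rule bijective_open_imp_homeomorphic_map)
  have U: "topspace X \<inter> U = U" using assms(3) openin_subset by blast
  have im: "topspace Y \<inter> f ` U = f ` U"
    using continuous_map_image_subset_topspace[OF assms(1)] U by blast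
  show "continuous_map (subtopology X U) (subtopology Y (f ` U)) f"
    using assms(1) by (auto simp: continuous_map_in_subtopology continuous_map_from_subtopology)
  show "open_map (subtopology X U) (subtopology Y (f ` U)) f"
    using assms(2,3) by (intro open_map_into_subtopology open_map_from_subtopology) auto
  show "f ` topspace (subtopology X U) = topspace (subtopology Y (f ` U))"
    using U im by simp
  show "inj_on f (topspace (subtopology X U))" using U assms(4) by simp
qed

section \<open>Cancellation and units in a groupoid\<close>

context groupoid
begin

lemma mul_arrows:
  "a \<in> arrows G \<Longrightarrow> b \<in> arrows G \<Longrightarrow> src G a = rng G b \<Longrightarrow> mul G a b \<in> arrows G"
  "a \<in> arrows G \<Longrightarrow> b \<in> arrows G \<Longrightarrow> src G a = rng G b \<Longrightarrow> src G (mul G a b) = src G b"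
  "a \<in> arrows G \<Longrightarrow> b \<in> arrows G \<Longrightarrow> src G a = rng G b \<Longrightarrow> rng G (mul G a b) = rng G a"
  using mul_closed src_mul rng_mul by (auto simp: composable_def)

lemma mul_assoc_arrows:
  "\<lbrakk>a \<in> arrows G; b \<in> arrows G; c \<in> arrows G; src G a = rng G b; src G b = rng G c\<rbrakk>
    \<Longrightarrow> mul G (mul G a b) c = mul G a (mul G b c)"
  using mul_assoc by (auto simp: composable_def)

lemma mul_inv_cancel_right:
  assumes "a \<in> arrows G" "b \<in> arrows G" "src G a = rng G b"
  shows "mul G (mul G a b) (ginv G b) = a"
  using assms mul_assoc_arrows[of a b "ginv G b"] by (simp add: inv_closed rng_inv mul_inv)
    (metis mul_src)

lemma mul_inv_cancel_middle:
  assumes "a \<in> arrows G" "b \<in> arrows G" "src G a = src G b"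
  shows "mul G (mul G a (ginv G b)) b = a"
  using assms mul_assoc_arrows[of a "ginv G b" b]
  by (simp add: inv_closed rng_inv src_inv inv_mul) (metis mul_src)

text \<open>Write c for the double inverse of a. Cancellation gives (a a^{-1}) c = a. But a a^{-1} =
  r(a) = r(c), so the left side is also c.\<close>

lemma inv_inv:
  assumes a: "a \<in> arrows G"
  shows "ginv G (ginv G a) = a"
  using mul_inv_cancel_right[of a "ginv G a"] a mul_inv[OF a]
    rng_mul_left[of "ginv G (ginv G a)"]
  by (simp add: inv_closed rng_inv src_inv)

text \<open>A unit is its own source, and the source of a b^{-1} is r(b). Hence a b^{-1} = r(b), and
  multiplying by b on the right gives a = b. In this form compatibility of two bisections identifies
  arrows with a common source.\<close>

lemma eq_if_mul_inv_unit:
  assumes "a \<in> arrows G" "b \<in> arrows G" "src G a = src G b" "mul G a (ginv G b) \<in> units G"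
  shows "a = b"
proof -
  have "mul G a (ginv G b) = src G (mul G a (ginv G b))"
    using assms(4) src_unit by simp
  also have "\<dots> = rng G b"
    using assms by (simp add: mul_arrows inv_closed src_inv rng_inv)
  finally show ?thesis
    using mul_inv_cancel_middle[OF assms(1-3)] assms(2) rng_mul_left by simp
qed

text \<open>Multiplying a a = a on the right by a^{-1} gives a = a a^{-1} = r(a).\<close>

lemma unit_if_idempotent:
  assumes "a \<in> arrows G" "src G a = rng G a" "mul G a a = a"
  shows "a \<in> units G"
  using mul_inv_cancel_right[of a a] assms mul_inv rng_units by metis

end

section \<open>Continuity of products and inverses\<close>

context topological_groupoid
begin

text \<open>This form of \<open>continuous_mul\<close> lets both factors depend continuously on a
  parameter; below the parameter is a single arrow from which the missing factor is
  reconstructed.\<close>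

lemma continuous_map_mul:
  assumes "continuous_map Z (arr_top G) f" "continuous_map Z (arr_top G) g"
    and "\<And>z. z \<in> topspace Z \<Longrightarrow> src G (f z) = rng G (g z)"
  shows "continuous_map Z (arr_top G) (\<lambda>z. mul G (f z) (g z))"
proof -
  have "continuous_map Z (subtopology (prod_topology (arr_top G) (arr_top G)) (composable G))
      (\<lambda>z. (f z, g z))"
    using assms continuous_map_image_subset_topspace[OF assms(1)]
      continuous_map_image_subset_topspace[OF assms(2)]
    by (auto simp: continuous_map_in_subtopology composable_def continuous_map_pairedI)
  from continuous_map_compose[OF this continuous_mul] show ?thesis
    by (simp add: o_def)
qed

lemma homeomorphic_map_inv: "homeomorphic_map (arr_top G) (arr_top G) (ginv G)"
  by (rule homeomorphic_maps_imp_map[of _ _ _ "ginv G"])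
     (simp add: homeomorphic_maps_def continuous_inv inv_inv)

lemma openin_set_inv: "openin (arr_top G) U \<Longrightarrow> openin (arr_top G) (set_inv G U)"
  using homeomorphic_imp_open_map[OF homeomorphic_map_inv]
  by (simp add: open_map_def set_inv_def)

end

section \<open>Source, range and the open unit space of an etale groupoid\<close>

context etale_groupoid
begin

lemma continuous_src: "continuous_map (arr_top G) (unit_space G) (src G)"
  using local_homeomorphism_src by (rule local_homeomorphism_map_imp_continuous_map)

lemma open_map_src: "open_map (arr_top G) (unit_space G) (src G)"
  using local_homeomorphism_src by (rule local_homeomorphism_map_imp_open_map)

text \<open>Inversion is continuous and r(a) = d(a^{-1}), so continuity passes from the source map
  to the range map. The next lemma transfers openness in the same way.\<close>

lemma continuous_rng: "continuous_map (arr_top G) (unit_space G) (rng G)"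
  using continuous_map_compose[OF continuous_inv continuous_src]
  by (rule continuous_map_eq) (simp add: src_inv)

lemma open_map_rng: "open_map (arr_top G) (unit_space G) (rng G)"
  unfolding open_map_def
proof (intro allI impI)
  fix U assume U: "openin (arr_top G) U"
  then have "openin (unit_space G) (src G ` set_inv G U)"
    using openin_set_inv open_map_src by (simp add: open_map_def)
  moreover have "src G ` set_inv G U = rng G ` U"
    using openin_subset[OF U] src_inv by (force simp: set_inv_def image_image)
  ultimately show "openin (unit_space G) (rng G ` U)" by simp
qed

text \<open>Let U be a neighbourhood of a unit on which d is injective. If both a and d(a) lie in U,
  then d(d(a)) = d(a) forces a = d(a), so a is a unit. The arrows a with this property form an open
  set, because d is continuous as a map into the arrow space.\<close>

lemma openin_units: "openin (arr_top G) (units G)"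
proof (subst openin_subopen, intro ballI)
  fix x assume x: "x \<in> units G"
  then have "x \<in> arrows G" using units_subset by blast
  then obtain U where U: "openin (arr_top G) U" "x \<in> U"
    and h: "homeomorphic_map (subtopology (arr_top G) U) (subtopology (unit_space G) (src G ` U)) (src G)"
    using local_homeomorphism_src unfolding local_homeomorphism_map_def by blast
  have Usub: "U \<subseteq> arrows G" using U openin_subset by blast
  have inj: "inj_on (src G) U"
    using homeomorphic_imp_injective_map[OF h] Usub by (simp add: Int_absorb1)
  let ?V = "{a \<in> arrows G. src G a \<in> U} \<inter> U"
  have "continuous_map (arr_top G) (arr_top G) (src G)"
    using continuous_src by (simp add: unit_space_def continuous_map_in_subtopology)
  then have "openin (arr_top G) ?V"
    using U openin_continuous_map_preimage by blast
  moreover have "?V \<subseteq> units G"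
  proof
    fix a assume a: "a \<in> ?V"
    then have "src G (src G a) = src G a" using src_units src_unit by blast
    then have "src G a = a" using inj a by (auto dest: inj_onD)
    then show "a \<in> units G" using a src_units by fastforce
  qed
  moreover have "x \<in> ?V" using x U \<open>x \<in> arrows G\<close> src_unit by simp
  ultimately show "\<exists>T. openin (arr_top G) T \<and> x \<in> T \<and> T \<subseteq> units G" by blast
qed

lemma openin_unit_space_iff: "openin (unit_space G) U \<longleftrightarrow> openin (arr_top G) U \<and> U \<subseteq> units G"
  by (simp add: unit_space_def openin_open_subtopology openin_units)

section \<open>Compact bisections and their products, inverses and idempotents\<close>

lemma open_bisection_iff:
  "open_bisection G U \<longleftrightarrow> openin (arr_top G) U \<and> inj_on (src G) U \<and> inj_on (rng G) U"
proof
  assume U: "open_bisection G U"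
  then have "arrows G \<inter> U = U"
    using openin_subset by (fastforce simp: open_bisection_def)
  then show "openin (arr_top G) U \<and> inj_on (src G) U \<and> inj_on (rng G) U"
    using U by (auto simp: open_bisection_def dest!: homeomorphic_imp_injective_map)
next
  assume "openin (arr_top G) U \<and> inj_on (src G) U \<and> inj_on (rng G) U"
  then show "open_bisection G U"
    unfolding open_bisection_def
    using homeomorphic_map_open_subset continuous_src open_map_src continuous_rng open_map_rng
    by blast
qed

lemma compact_bisections_iff:
  "U \<in> compact_bisections G \<longleftrightarrow> openin (arr_top G) U \<and> compactin (arr_top G) U \<and>
     inj_on (src G) U \<and> inj_on (rng G) U"
  by (auto simp: compact_bisections_def open_bisection_iff)

text \<open>The map s is the continuous inverse of d restricted to U. It recovers an arrow of U from
  its source, so that one factor of a product of bisections can be expressed through other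
  data.\<close>

lemma src_section:
  assumes U: "openin (arr_top G) U" and inj: "inj_on (src G) U"
  obtains s where "continuous_map (subtopology (unit_space G) (src G ` U)) (arr_top G) s"
    and "\<And>a. a \<in> U \<Longrightarrow> s (src G a) = a"
proof -
  have Usub: "U \<subseteq> arrows G" using U openin_subset by blast
  have "homeomorphic_map (subtopology (arr_top G) U) (subtopology (unit_space G) (src G ` U)) (src G)"
    using homeomorphic_map_open_subset[OF continuous_src open_map_src U inj] .
  then obtain s where "homeomorphic_maps (subtopology (arr_top G) U)
      (subtopology (unit_space G) (src G ` U)) (src G) s"
    by (auto simp: homeomorphic_map_maps)
  then show ?thesis
    using that[of s] Usub
    by (auto simp: homeomorphic_maps_def continuous_map_in_subtopology)
qed

text \<open>If c = ab with b in V, then d(c) = d(b), hence b = s(d(c)) and a = c b^{-1}. So UV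
  consists of the arrows c in the open set \<open>?D\<close> for which c s(d(c))^{-1} lies in U: it
  is the preimage of U under the continuous map \<open>?f\<close>, and no openness of multiplication
  has to be shown first.\<close>

lemma openin_set_mul:
  assumes U: "openin (arr_top G) U" and V: "openin (arr_top G) V" and inj: "inj_on (src G) V"
  shows "openin (arr_top G) (set_mul G U V)"
proof -
  have sub: "U \<subseteq> arrows G" "V \<subseteq> arrows G" using U V openin_subset by blast+
  obtain s where s: "continuous_map (subtopology (unit_space G) (src G ` V)) (arr_top G) s"
    and s_src: "\<And>a. a \<in> V \<Longrightarrow> s (src G a) = a"
    using src_section[OF V inj] by blast
  let ?D = "{c \<in> arrows G. src G c \<in> src G ` V}"
  let ?Z = "subtopology (arr_top G) ?D"
  let ?f = "\<lambda>c. mul G c (ginv G (s (src G c)))"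
  have "openin (unit_space G) (src G ` V)" using V open_map_src by (simp add: open_map_def)
  then have D: "openin (arr_top G) ?D"
    using continuous_src openin_continuous_map_preimage by blast
  have "continuous_map ?Z (subtopology (unit_space G) (src G ` V)) (src G)"
    using continuous_src
    by (auto simp: continuous_map_in_subtopology continuous_map_from_subtopology)
  from continuous_map_compose[OF continuous_map_compose[OF this s] continuous_inv]
  have "continuous_map ?Z (arr_top G) (\<lambda>c. ginv G (s (src G c)))" by (simp add: o_def)
  then have "continuous_map ?Z (arr_top G) ?f"
    using sub s_src rng_inv
    by (intro continuous_map_mul) (auto simp: subset_iff continuous_map_from_subtopology)
  then have "openin ?Z {c \<in> topspace ?Z. ?f c \<in> U}"
    using U openin_continuous_map_preimage by blast
  then have "openin (arr_top G) {c \<in> topspace ?Z. ?f c \<in> U}"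
    using D openin_open_subtopology by blast
  moreover have "{c \<in> topspace ?Z. ?f c \<in> U} = set_mul G U V"
  proof (intro equalityI subsetI)
    fix c assume "c \<in> {c \<in> topspace ?Z. ?f c \<in> U}"
    then obtain b where c: "c \<in> arrows G" "?f c \<in> U" and b: "b \<in> V" "src G c = src G b"
      by auto
    have "b \<in> arrows G" using b sub by blast
    then have "c = mul G (?f c) b" "src G (?f c) = rng G b"
      using c b s_src[OF b(1)]
      by (simp_all add: mul_inv_cancel_middle mul_arrows inv_closed rng_inv src_inv)
    then show "c \<in> set_mul G U V"
      using c(2) b(1) unfolding set_mul_def by blast
  next
    fix c assume "c \<in> set_mul G U V"
    then obtain a b where "c = mul G a b" "a \<in> U" "b \<in> V" "src G a = rng G b"
      by (auto simp: set_mul_def)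
    moreover from this have "a \<in> arrows G" "b \<in> arrows G" using sub by auto
    ultimately show "c \<in> {c \<in> topspace ?Z. ?f c \<in> U}"
      by (simp add: mul_arrows s_src mul_inv_cancel_right)
  qed
  ultimately show ?thesis by simp
qed

text \<open>In a product ab with a in U, the left factor is a = s(r(b)), so UV is the continuous
  image of those b in V with r(b) in d(U). Since the unit space is Hausdorff, the compact set d(U)
  is closed; this part of V is therefore the intersection of V with a closed set, hence compact. The
  arrow space itself may fail to be Hausdorff.\<close>

lemma compactin_set_mul:
  assumes H: "Hausdorff_space (unit_space G)"
    and U: "openin (arr_top G) U" "compactin (arr_top G) U" and inj: "inj_on (src G) U"
    and V: "compactin (arr_top G) V"
  shows "compactin (arr_top G) (set_mul G U V)"
proof -
  have sub: "U \<subseteq> arrows G" "V \<subseteq> arrows G" using U V compactin_subset_topspace by blast+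
  obtain s where s: "continuous_map (subtopology (unit_space G) (src G ` U)) (arr_top G) s"
    and s_src: "\<And>a. a \<in> U \<Longrightarrow> s (src G a) = a"
    using src_section[OF U(1) inj] by blast
  let ?D = "{c \<in> arrows G. rng G c \<in> src G ` U}"
  let ?Z = "subtopology (arr_top G) ?D"
  let ?f = "\<lambda>c. mul G (s (rng G c)) c"
  have "compactin (unit_space G) (src G ` U)"
    using U(2) continuous_src image_compactin by blast
  then have "closedin (unit_space G) (src G ` U)"
    using H compactin_imp_closedin by blast
  then have "closedin (arr_top G) ?D"
    using continuous_rng closedin_continuous_map_preimage by blast
  then have K: "compactin ?Z (?D \<inter> V)"
    using V closed_Int_compactin by (simp add: compactin_subtopology)
  have "continuous_map ?Z (subtopology (unit_space G) (src G ` U)) (rng G)"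
    using continuous_rng
    by (auto simp: continuous_map_in_subtopology continuous_map_from_subtopology)
  from continuous_map_compose[OF this s]
  have "continuous_map ?Z (arr_top G) (\<lambda>c. s (rng G c))" by (simp add: o_def)
  then have "continuous_map ?Z (arr_top G) ?f"
    using s_src by (intro continuous_map_mul) (auto simp: continuous_map_from_subtopology)
  then have "compactin (arr_top G) (?f ` (?D \<inter> V))"
    using K image_compactin by blast
  moreover have "?f ` (?D \<inter> V) = set_mul G U V"
  proof (intro equalityI subsetI)
    fix c assume "c \<in> ?f ` (?D \<inter> V)"
    then obtain a b where "c = ?f b" "b \<in> V" "a \<in> U" "rng G b = src G a" by auto
    then show "c \<in> set_mul G U V" using s_src unfolding set_mul_def by force
  next
    fix c assume "c \<in> set_mul G U V"
    then obtain a b where c: "c = mul G a b" "a \<in> U" "b \<in> V" "src G a = rng G b"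
      by (auto simp: set_mul_def)
    then have "c = ?f b" using s_src[of a] by simp
    moreover have "b \<in> ?D \<inter> V" using c sub by (auto intro: rev_image_eqI)
    ultimately show "c \<in> ?f ` (?D \<inter> V)" by blast
  qed
  ultimately show ?thesis by simp
qed

lemma set_mul_in_compact_bisections:
  assumes "Hausdorff_space (unit_space G)"
    and U: "U \<in> compact_bisections G" and V: "V \<in> compact_bisections G"
  shows "set_mul G U V \<in> compact_bisections G"
proof -
  have sub: "U \<subseteq> arrows G" "V \<subseteq> arrows G"
    using U V openin_subset by (auto simp: compact_bisections_iff)
  \<comment> \<open>If ab and a'b' have the same source, then d(b) = d(b') gives b = b', and d(a) =
    r(b) = d(a') then gives a = a'. The argument for ranges starts with the left factors.\<close>
  have "inj_on (src G) (set_mul G U V)" "inj_on (rng G) (set_mul G U V)"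
    using U V sub unfolding compact_bisections_iff inj_on_def set_mul_def
    by (simp_all add: subset_iff) (metis mul_arrows)+
  then show ?thesis
    using assms by (auto simp: compact_bisections_iff openin_set_mul compactin_set_mul)
qed

lemma set_inv_in_compact_bisections:
  assumes U: "U \<in> compact_bisections G"
  shows "set_inv G U \<in> compact_bisections G"
proof -
  have sub: "U \<subseteq> arrows G" using U openin_subset by (auto simp: compact_bisections_iff)
  have "compactin (arr_top G) (set_inv G U)"
    using U image_compactin continuous_inv by (auto simp: compact_bisections_iff set_inv_def)
  moreover have "inj_on (src G) (set_inv G U)" "inj_on (rng G) (set_inv G U)"
    using U sub unfolding compact_bisections_iff inj_on_def set_inv_def
    by (auto simp: subset_iff src_inv rng_inv)
  ultimately show ?thesis
    using U openin_set_inv by (auto simp: compact_bisections_iff)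
qed

text \<open>If UU = U, write a in U as bc with b, c in U. Then a shares its source with c and its
  range with b, so injectivity gives a = b = c. Thus a = aa is composable with itself and is a unit.
  Conversely, source and range are the identity on a set of units, and distinct units are never
  composable.\<close>

lemma idempotent_bisections_iff:
  "U \<in> idempotent_bisections G \<longleftrightarrow>
     openin (arr_top G) U \<and> compactin (arr_top G) U \<and> U \<subseteq> units G"
proof
  assume "U \<in> idempotent_bisections G"
  then have U: "U \<in> compact_bisections G" and idem: "set_mul G U U = U"
    by (auto simp: idempotent_bisections_def)
  have sub: "U \<subseteq> arrows G" using U openin_subset by (auto simp: compact_bisections_iff)
  have "a \<in> units G" if a: "a \<in> U" for a
  proof -
    have "a \<in> set_mul G U U" using a idem by simp
    then obtain b c where bc: "a = mul G b c" "b \<in> U" "c \<in> U" "src G b = rng G c"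
      unfolding set_mul_def by blast
    then have "src G a = src G c" "rng G a = rng G b"
      using sub by (auto simp: subset_iff mul_arrows)
    then have "a = c" "a = b"
      using U a bc by (auto simp: compact_bisections_iff inj_on_def)
    then show ?thesis using bc sub a unit_if_idempotent[of a] by auto
  qed
  then show "openin (arr_top G) U \<and> compactin (arr_top G) U \<and> U \<subseteq> units G"
    using U by (auto simp: compact_bisections_iff)
next
  assume U: "openin (arr_top G) U \<and> compactin (arr_top G) U \<and> U \<subseteq> units G"
  have unit: "src G x = x \<and> rng G x = x \<and> mul G x x = x" if "x \<in> U" for x
  proof -
    have "x \<in> units G" "x \<in> arrows G" using that U units_subset by auto
    then show ?thesis using src_unit rng_unit mul_src[of x] by simp
  qed
  then have "inj_on (src G) U" "inj_on (rng G) U"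
    by (auto simp: inj_on_def)
  moreover have "set_mul G U U = U"
  proof (intro equalityI subsetI)
    fix c assume "c \<in> set_mul G U U"
    then show "c \<in> U" using unit by (auto simp: set_mul_def)
  next
    fix c assume "c \<in> U"
    then show "c \<in> set_mul G U U" using unit unfolding set_mul_def by force
  qed
  ultimately show "U \<in> idempotent_bisections G"
    using U by (auto simp: compact_bisections_iff idempotent_bisections_def)
qed

text \<open>A product a^{-1} b with a in K and b in L is defined only when r(a) = r(b). Both arrows
  lie in U, on which r is injective, so a = b and the product is a unit. For a b^{-1} the same works
  with sources.\<close>

lemma compatible_if_subset_bisection:
  assumes H: "Hausdorff_space (unit_space G)" and U: "U \<in> compact_bisections G"
    and K: "K \<in> compact_bisections G" "K \<subseteq> U" and L: "L \<in> compact_bisections G" "L \<subseteq> U"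
  shows "compatible G K L"
proof -
  have sub: "U \<subseteq> arrows G" using U openin_subset by (auto simp: compact_bisections_iff)
  have inj: "inj_on (src G) U" "inj_on (rng G) U"
    using U by (auto simp: compact_bisections_iff)
  have "set_mul G (set_inv G K) L \<subseteq> units G"
  proof
    fix c assume "c \<in> set_mul G (set_inv G K) L"
    then obtain a b where c: "c = mul G (ginv G a) b" "a \<in> K" "b \<in> L" "src G (ginv G a) = rng G b"
      by (auto simp: set_mul_def set_inv_def)
    then have ab: "a \<in> U" "b \<in> U" "a \<in> arrows G" using K L sub by auto
    then have "rng G a = rng G b" using c by (simp add: src_inv)
    then have "a = b" using inj_onD[OF inj(2)] ab by blast
    then show "c \<in> units G" using c ab by (simp add: inv_mul src_units)
  qed
  moreover have "set_mul G K (set_inv G L) \<subseteq> units G"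
  proof
    fix c assume "c \<in> set_mul G K (set_inv G L)"
    then obtain a b where c: "c = mul G a (ginv G b)" "a \<in> K" "b \<in> L" "src G a = rng G (ginv G b)"
      by (auto simp: set_mul_def set_inv_def)
    then have ab: "a \<in> U" "b \<in> U" "b \<in> arrows G" using K L sub by auto
    then have "src G a = src G b" using c by (simp add: rng_inv)
    then have "a = b" using inj_onD[OF inj(1)] ab by blast
    then show "c \<in> units G" using c ab by (simp add: mul_inv rng_units)
  qed
  ultimately show ?thesis
    using set_mul_in_compact_bisections[OF H] set_inv_in_compact_bisections K(1) L(1)
    by (simp add: compatible_def idempotent_bisections_iff compact_bisections_iff)
qed

text \<open>Only injectivity across U and V needs an argument. If a in U and b in V have equal
  sources, a b^{-1} is defined and compatibility makes it a unit, so a = b.\<close>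

lemma compatible_union_in_compact_bisections:
  assumes U: "U \<in> compact_bisections G" and V: "V \<in> compact_bisections G"
    and C: "compatible G U V"
  shows "U \<union> V \<in> compact_bisections G"
proof -
  have sub: "U \<subseteq> arrows G" "V \<subseteq> arrows G"
    using U V openin_subset by (auto simp: compact_bisections_iff)
  have units: "set_mul G (set_inv G U) V \<subseteq> units G" "set_mul G U (set_inv G V) \<subseteq> units G"
    using C by (auto simp: compatible_def idempotent_bisections_iff)
  have src_eq: "a = b" if ab: "a \<in> U" "b \<in> V" "src G a = src G b" for a b
  proof (rule eq_if_mul_inv_unit)
    show arr: "a \<in> arrows G" "b \<in> arrows G" using ab sub by auto
    have "src G a = rng G (ginv G b)" using arr ab by (simp add: rng_inv)
    then show "mul G a (ginv G b) \<in> units G"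
      using ab units(2) unfolding set_mul_def set_inv_def by blast
  qed fact
  have rng_eq: "a = b" if ab: "a \<in> U" "b \<in> V" "rng G a = rng G b" for a b
  proof -
    have arr: "a \<in> arrows G" "b \<in> arrows G" using ab sub by auto
    have "src G (ginv G a) = rng G b" using arr ab by (simp add: src_inv)
    then have "mul G (ginv G a) b \<in> units G"
      using ab units(1) unfolding set_mul_def set_inv_def by blast
    \<comment> \<open>The range case is the source case for the inverses: b is the inverse of
      b^{-1}, so the unit a^{-1} b has the required form.\<close>
    then have "ginv G a = ginv G b"
      using eq_if_mul_inv_unit[of "ginv G a" "ginv G b"] arr ab
      by (simp add: inv_closed src_inv inv_inv)
    then show ?thesis using arr inv_inv by metis
  qed
  have "inj_on (src G) (U \<union> V)" "inj_on (rng G) (U \<union> V)"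
    using U V src_eq rng_eq unfolding compact_bisections_iff inj_on_def by (metis UnE)+
  then show ?thesis
    using U V by (auto simp: compact_bisections_iff compactin_Un)
qed

text \<open>Right multiplication by a set of units keeps exactly the arrows of V whose source lies
  in that set. For the units d(K) these are the arrows of K, since d is injective on V.\<close>

lemma restrict_bisection:
  assumes V: "V \<in> compact_bisections G" and "K \<subseteq> V"
  shows "set_mul G V (src G ` K) = K"
proof -
  have sub: "V \<subseteq> arrows G" and inj: "inj_on (src G) V"
    using V openin_subset by (auto simp: compact_bisections_iff)
  have rng_src: "rng G (src G a) = src G a" if "a \<in> V" for a
    using that sub src_units rng_unit by blast
  show ?thesis
  proof (intro equalityI subsetI)
    fix c assume "c \<in> set_mul G V (src G ` K)"
    then obtain a b where c: "c = mul G a (src G b)" "a \<in> V" "b \<in> K" "src G a = rng G (src G b)"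
      by (auto simp: set_mul_def)
    then have "b \<in> V" "src G a = src G b" using rng_src[of b] assms(2) by auto
    then have "a = b" using inj c(2) by (auto dest: inj_onD)
    then show "c \<in> K" using c sub mul_src by auto
  next
    fix c assume c: "c \<in> K"
    then have "c = mul G c (src G c)" "src G c = rng G (src G c)" "c \<in> V"
      using sub assms(2) mul_src rng_src by (auto simp: subset_iff)
    then show "c \<in> set_mul G V (src G ` K)"
      using c unfolding set_mul_def by blast
  qed
qed

end

section \<open>Compact bisections as a basis, and the two directions of the correspondence\<close>

context ample_groupoid
begin

lemma compact_open_nbhd:
  assumes "openin (arr_top G) W" "a \<in> W"
  obtains K where "openin (arr_top G) K" "compactin (arr_top G) K" "a \<in> K" "K \<subseteq> W"
proof -
  obtain B where B: "\<forall>K \<in> B. openin (arr_top G) K \<and> compactin (arr_top G) K"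
    and U: "openin (arr_top G) = arbitrary union_of (\<lambda>K. K \<in> B)"
    using compact_open_basis by blast
  have "(arbitrary union_of (\<lambda>K. K \<in> B)) W" using assms(1) U by simp
  then obtain \<U> where "\<U> \<subseteq> B" "\<Union>\<U> = W"
    by (auto simp: union_of_def arbitrary_def)
  then show ?thesis using assms(2) B that by blast
qed

text \<open>The etale condition supplies a neighbourhood with injective source only. Inversion
  exchanges source and range, so such a neighbourhood of a^{-1} becomes, after inverting, a
  neighbourhood of a with injective range. A compact open set inside the intersection of both with W
  is the required bisection.\<close>

lemma compact_bisection_nbhd:
  assumes W: "openin (arr_top G) W" "a \<in> W"
  obtains K where "K \<in> compact_bisections G" "a \<in> K" "K \<subseteq> W"
proof -
  have src_inj: "\<exists>U. openin (arr_top G) U \<and> b \<in> U \<and> inj_on (src G) U" if b: "b \<in> arrows G" for b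
  proof -
    obtain U where U: "openin (arr_top G) U" "b \<in> U"
      and h: "homeomorphic_map (subtopology (arr_top G) U) (subtopology (unit_space G) (src G ` U)) (src G)"
      using local_homeomorphism_src b unfolding local_homeomorphism_map_def by blast
    have "inj_on (src G) U"
      using homeomorphic_imp_injective_map[OF h] openin_subset[OF U(1)] by (simp add: Int_absorb1)
    with U show ?thesis by blast
  qed
  have a: "a \<in> arrows G" using W openin_subset by blast
  obtain U where U: "openin (arr_top G) U" "a \<in> U" "inj_on (src G) U"
    using src_inj a by blast
  obtain V where V: "openin (arr_top G) V" "ginv G a \<in> V" "inj_on (src G) V"
    using src_inj inv_closed a by blast
  have Vsub: "V \<subseteq> arrows G" using V openin_subset by blast
  have aV: "a \<in> set_inv G V"
    using V inv_inv[OF a] unfolding set_inv_def by force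
  have inj: "inj_on (rng G) (set_inv G V)"
    using V Vsub by (auto simp: inj_on_def set_inv_def subset_iff rng_inv)
  obtain K where K: "openin (arr_top G) K" "compactin (arr_top G) K" "a \<in> K"
    "K \<subseteq> W \<inter> U \<inter> set_inv G V"
    using compact_open_nbhd[of "W \<inter> U \<inter> set_inv G V" a] W U V aV openin_set_inv
    by (metis IntI openin_Int)
  then have "inj_on (src G) K" "inj_on (rng G) K"
    using U inj inj_on_subset by blast+
  then show ?thesis using that K by (auto simp: compact_bisections_iff)
qed

lemma Union_compact_bisections_subset:
  assumes "openin (arr_top G) W"
  shows "\<Union>{U \<in> compact_bisections G. U \<subseteq> W} = W"
  using compact_bisection_nbhd[OF assms] by blast

lemma subset_bisections_wide_join_closed:
  assumes Hd: "Hausdorff_space (unit_space G)" and H: "open_wide_subgroupoid G H"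
  shows "wide_subsemigroup G {U \<in> compact_bisections G. U \<subseteq> H} \<and>
    join_closed G {U \<in> compact_bisections G. U \<subseteq> H}"
proof -
  let ?T = "{U \<in> compact_bisections G. U \<subseteq> H}"
  have "set_mul G U V \<in> ?T" if "U \<in> ?T" "V \<in> ?T" for U V
  proof -
    have "set_mul G U V \<subseteq> H"
      using H that unfolding open_wide_subgroupoid_def set_mul_def by blast
    then show ?thesis using that set_mul_in_compact_bisections[OF Hd] by simp
  qed
  moreover have "set_inv G U \<in> ?T" if "U \<in> ?T" for U
  proof -
    have "set_inv G U \<subseteq> H"
      using H that unfolding open_wide_subgroupoid_def set_inv_def by blast
    then show ?thesis using that set_inv_in_compact_bisections by simp
  qed
  moreover have "U \<in> ?T" if U: "U \<in> idempotent_bisections G" for U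
  proof -
    have "U \<subseteq> H"
      using H U idempotent_bisections_iff[of U] unfolding open_wide_subgroupoid_def by blast
    then show ?thesis using U by (simp add: idempotent_bisections_def)
  qed
  ultimately have "wide_subsemigroup G ?T"
    unfolding wide_subsemigroup_def bisection_subsemigroup_def by blast
  moreover have "join_closed G ?T"
    using compatible_union_in_compact_bisections by (simp add: join_closed_def)
  ultimately show ?thesis by blast
qed

lemma Union_open_wide_subgroupoid:
  assumes T: "wide_subsemigroup G T"
  shows "open_wide_subgroupoid G (\<Union>T)"
proof -
  have TB: "T \<subseteq> compact_bisections G" and idem: "idempotent_bisections G \<subseteq> T"
    and mulT: "\<And>U V. U \<in> T \<Longrightarrow> V \<in> T \<Longrightarrow> set_mul G U V \<in> T"
    and invT: "\<And>U. U \<in> T \<Longrightarrow> set_inv G U \<in> T"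
    using T by (auto simp: wide_subsemigroup_def bisection_subsemigroup_def)
  have "openin (arr_top G) (\<Union>T)"
    using TB compact_bisections_iff by (intro openin_Union) blast
  \<comment> \<open>A compact open neighbourhood of x inside the open set of units is an idempotent
    bisection, hence a member of T.\<close>
  moreover have "x \<in> \<Union>T" if "x \<in> units G" for x
    using compact_open_nbhd[OF openin_units that] idem idempotent_bisections_iff
    by (metis UnionI subsetD)
  moreover have "mul G a b \<in> \<Union>T" if ab: "a \<in> \<Union>T" "b \<in> \<Union>T" "src G a = rng G b" for a b
  proof -
    obtain U V where UV: "U \<in> T" "V \<in> T" "a \<in> U" "b \<in> V" using ab by blast
    then have "mul G a b \<in> set_mul G U V" using ab(3) unfolding set_mul_def by blast
    then show ?thesis using mulT UV by blast
  qed
  moreover have "ginv G a \<in> \<Union>T" if "a \<in> \<Union>T" for a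
    using that invT unfolding set_inv_def by blast
  ultimately show ?thesis by (auto simp: open_wide_subgroupoid_def)
qed

lemma mem_if_subset_Union:
  assumes Hd: "Hausdorff_space (unit_space G)"
    and T: "wide_subsemigroup G T" and J: "join_closed G T"
    and U: "U \<in> compact_bisections G" "U \<subseteq> \<Union>T"
  shows "U \<in> T"
proof -
  have TB: "T \<subseteq> compact_bisections G" and idem: "idempotent_bisections G \<subseteq> T"
    and mulT: "\<And>U V. U \<in> T \<Longrightarrow> V \<in> T \<Longrightarrow> set_mul G U V \<in> T"
    using T by (auto simp: wide_subsemigroup_def bisection_subsemigroup_def)
  have small: "K \<in> T" if K: "K \<in> compact_bisections G" "K \<subseteq> V" "V \<in> T" for K V
  proof -
    have "openin (unit_space G) (src G ` K)"
      using K open_map_src by (auto simp: compact_bisections_iff open_map_def)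
    moreover have "compactin (arr_top G) (src G ` K)"
      using K(1) continuous_src image_compactin[of "arr_top G" K "unit_space G" "src G"]
      by (simp add: compact_bisections_iff unit_space_def compactin_subtopology)
    ultimately have "src G ` K \<in> idempotent_bisections G"
      by (simp add: idempotent_bisections_iff openin_unit_space_iff)
    then have "src G ` K \<in> T" using idem by blast
    then have "set_mul G V (src G ` K) \<in> T" using mulT K by blast
    moreover have "set_mul G V (src G ` K) = K"
      using restrict_bisection K TB by blast
    ultimately show ?thesis by simp
  qed
  let ?C = "{K \<in> T. K \<subseteq> U}"
  have "U \<subseteq> \<Union>?C"
  proof
    fix a assume a: "a \<in> U"
    then obtain V where V: "V \<in> T" "a \<in> V" using U by blast
    then have "openin (arr_top G) (U \<inter> V)"
      using U TB compact_bisections_iff by blast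
    then obtain K where "K \<in> compact_bisections G" "a \<in> K" "K \<subseteq> U \<inter> V"
      using compact_bisection_nbhd a V by (metis IntI)
    then show "a \<in> \<Union>?C" using small V by auto
  qed
  moreover have "\<And>K. K \<in> ?C \<Longrightarrow> openin (arr_top G) K"
    using TB compact_bisections_iff by blast
  moreover have "compactin (arr_top G) U" using U by (simp add: compact_bisections_iff)
  ultimately obtain F where F: "finite F" "F \<subseteq> ?C" "U \<subseteq> \<Union>F"
    using compactinD[of "arr_top G" U ?C] by blast
  \<comment> \<open>The claim is membership in \<open>?C\<close> and not merely in T: the bound by U
    is what makes the next set K compatible with the union built so far. The empty union is covered
    because the empty set is an idempotent bisection.\<close>
  have "\<Union>F \<in> ?C" using F(1,2)
  proof (induction F)
    case empty
    have "{} \<in> idempotent_bisections G" by (simp add: idempotent_bisections_iff)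
    then show ?case using idem by auto
  next
    case (insert K F)
    then have K: "K \<in> T" "K \<subseteq> U" and F: "\<Union>F \<in> T" "\<Union>F \<subseteq> U" by auto
    have "compatible G K (\<Union>F)"
      by (rule compatible_if_subset_bisection[OF Hd U(1)]) (use K F TB in auto)
    then have "K \<union> \<Union>F \<in> T" using J K F by (simp add: join_closed_def)
    then show ?case using K F by simp
  qed
  moreover from this F(3) have "\<Union>F = U" by blast
  ultimately show ?thesis by simp
qed

end

theorem corollary4p1p3:
  fixes G :: "'a groupoid_struct"
  assumes "ample_groupoid G"
    and "locally_compact_space (unit_space G)"
    and "Hausdorff_space (unit_space G)"
  shows "\<exists>f. bij_betw f {H. open_wide_subgroupoid G H}
                       {T. wide_subsemigroup G T \<and> join_closed G T}"
proof -
  interpret ample_groupoid G by fact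
  have "bij_betw (\<lambda>H. {U \<in> compact_bisections G. U \<subseteq> H}) {H. open_wide_subgroupoid G H}
      {T. wide_subsemigroup G T \<and> join_closed G T}"
  proof (rule bij_betw_byWitness[where f' = Union])
    show "\<forall>H\<in>{H. open_wide_subgroupoid G H}. \<Union>{U \<in> compact_bisections G. U \<subseteq> H} = H"
      using Union_compact_bisections_subset by (auto simp: open_wide_subgroupoid_def)
    show "\<forall>T\<in>{T. wide_subsemigroup G T \<and> join_closed G T}.
        {U \<in> compact_bisections G. U \<subseteq> \<Union>T} = T"
    proof clarify
      fix T assume T: "wide_subsemigroup G T" "join_closed G T"
      then have "T \<subseteq> compact_bisections G"
        by (simp add: wide_subsemigroup_def bisection_subsemigroup_def)
      then show "{U \<in> compact_bisections G. U \<subseteq> \<Union>T} = T"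
        using mem_if_subset_Union[OF assms(3) T] by blast
    qed
    show "(\<lambda>H. {U \<in> compact_bisections G. U \<subseteq> H}) ` {H. open_wide_subgroupoid G H}
        \<subseteq> {T. wide_subsemigroup G T \<and> join_closed G T}"
      using subset_bisections_wide_join_closed[OF assms(3)] by blast
    show "Union ` {T. wide_subsemigroup G T \<and> join_closed G T}
        \<subseteq> {H. open_wide_subgroupoid G H}"
      using Union_open_wide_subgroupoid by blast
  qed
  then show ?thesis by blast
qed

end
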